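(* Let $\{e_1,e_2,\dots\}$ be the natural basis of the complex Banach space $c_0$, and let $A:c_0\to c_0$ be the bounded linear operator determined by $$A(e_1)=\sum_{k=2}^\infty \frac1k e_k,\qquad A(e_i)=-\frac1i e_i\quad (i\ge 2).$$ Let $T_t=e^{tA}$ for $t>0$. Then $$T_t(e_1)=e_1+\sum_{k=2}^\infty\bigl(1-e^{-t/k}\bigr)e_k,\qquad T_t(e_i)=e^{-t/i}e_i\quad(i\ge2),$$ and $(T_t)_{t>0}$ is a $C_0$-semigroup of contractions on $c_0$ with generator $A$. Moreover, $\langle T_t e_1,e_1^*\rangle=1$ for all $t>0$, where $e_1^*\in J(e_1)$ is $e_1$ viewed as a member of $\ell_1=c_0^*$; the operator $A$ has no eigenvector associated with any purely imaginary eigenvalue or with the eigenvalue $0$; and for every $k\ge 2$, $e_k$ is an eigenvector of $A$ associated with the eigenvalue $-\frac1k$. In particular, there exist a $C_0$ contraction semigroup $(T_t)_{t>0}$ on $c_0$, a unit vector $x\in c_0$ and $x^*\in J(x)$ with $|\langle T_t x,x^*\rangle|\to 1$ as $t\to\infty$, such that no unit vector $y\in c_0$ is an eigenvector of the generator of $(T_t)_{t>0}$ associated with a purely imaginary eigenvalue (including $0$).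
   Context: $c_0$ is the complex Banach space of complex sequences converging to $0$ with the supremum norm, and $e_k$ is the sequence with $1$ in position $k$ and $0$ elsewhere. Its dual is $\ell_1$ and $\langle\cdot,\cdot\rangle$ denotes the duality pairing. For a complex Banach space $X$ and a unit vector $x\in X$, $J(x)=\{x^*\in X^*:\langle x,x^*\rangle=1=\|x^*\|\}$ (the duality mapping). A $C_0$ contraction semigroup is a strongly continuous one-parameter semigroup of bounded linear operators (with $T_t\to I$ strongly as $t\downarrow0$) satisfying $\|T_t\|\le 1$ for all $t$. The operator $A$ is given explicitly by $A(a_1,a_2,\dots)=\sum_{k=2}^\infty \frac{a_1-a_k}{k}e_k$. *)

theory Defs
  imports "HOL-Analysis.Analysis"
begin

section \<open>Complex Banach spaces\<close>

text \<open>The real structure is inherited from the library; scaleC extends the real scalar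
  multiplication, and the norm is homogeneous for complex scalars.\<close>

class complex_normed_vector = real_normed_vector +
  fixes scaleC :: "complex \<Rightarrow> 'a \<Rightarrow> 'a"  (infixr "*\<^sub>C" 75)
  assumes scaleC_add_right: "c *\<^sub>C (x + y) = c *\<^sub>C x + c *\<^sub>C y"
    and scaleC_add_left: "(c + d) *\<^sub>C x = c *\<^sub>C x + d *\<^sub>C x"
    and scaleC_scaleC: "c *\<^sub>C (d *\<^sub>C x) = (c * d) *\<^sub>C x"
    and scaleC_one: "1 *\<^sub>C x = x"
    and scaleR_scaleC: "r *\<^sub>R x = complex_of_real r *\<^sub>C x"
    and norm_scaleC: "norm (c *\<^sub>C x) = cmod c * norm x"

class complex_banach = complex_normed_vector + banach

instantiation complex :: complex_banach
begin

definition scaleC_complex :: "complex \<Rightarrow> complex \<Rightarrow> complex"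
  where "scaleC_complex = (*)"

instance
  by standard
    (simp_all add: scaleC_complex_def algebra_simps scaleR_conv_of_real norm_mult)

end

text \<open>Elements of \<open>'a \<Rightarrow>\<^sub>L 'b\<close> are bounded and real linear; the bounded complex linear operators
  are those that moreover satisfy the following.  The norm on \<open>'a \<Rightarrow>\<^sub>L 'b\<close> is the operator norm.\<close>

definition clinear :: "('a::complex_normed_vector \<Rightarrow>\<^sub>L 'b::complex_normed_vector) \<Rightarrow> bool"
  where "clinear f \<longleftrightarrow> (\<forall>c x. blinfun_apply f (c *\<^sub>C x) = c *\<^sub>C blinfun_apply f x)"

definition duality_map :: "'a::complex_banach \<Rightarrow> ('a \<Rightarrow>\<^sub>L complex) set"
  where "duality_map x = {f. clinear f \<and> blinfun_apply f x = 1 \<and> norm f = 1}"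


section \<open>One-parameter semigroups and generators\<close>

text \<open>A semigroup \<open>(T t)\<close> is indexed by \<open>t > 0\<close>; the values of \<open>T\<close> at other reals are irrelevant.\<close>

definition C0_semigroup :: "(real \<Rightarrow> ('a::complex_banach \<Rightarrow>\<^sub>L 'a)) \<Rightarrow> bool"
  where "C0_semigroup T \<longleftrightarrow>
    (\<forall>t>0. clinear (T t)) \<and>
    (\<forall>s>0. \<forall>t>0. T (s + t) = T s o\<^sub>L T t) \<and>
    (\<forall>x. continuous_on {0<..} (\<lambda>t. blinfun_apply (T t) x)) \<and>
    (\<forall>x. ((\<lambda>t. blinfun_apply (T t) x) \<longlongrightarrow> x) (at_right 0))"

definition C0_contraction_semigroup :: "(real \<Rightarrow> ('a::complex_banach \<Rightarrow>\<^sub>L 'a)) \<Rightarrow> bool"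
  where "C0_contraction_semigroup T \<longleftrightarrow> C0_semigroup T \<and> (\<forall>t>0. norm (T t) \<le> 1)"

definition generator_domain :: "(real \<Rightarrow> ('a::complex_banach \<Rightarrow>\<^sub>L 'a)) \<Rightarrow> 'a set"
  where "generator_domain T =
    {x. \<exists>y. ((\<lambda>h. (1 / h) *\<^sub>R (blinfun_apply (T h) x - x)) \<longlongrightarrow> y) (at_right 0)}"

definition generator :: "(real \<Rightarrow> ('a::complex_banach \<Rightarrow>\<^sub>L 'a)) \<Rightarrow> 'a \<Rightarrow> 'a"
  where "generator T x = Lim (at_right 0) (\<lambda>h. (1 / h) *\<^sub>R (blinfun_apply (T h) x - x))"

definition eigenvector_on :: "'a::complex_banach set \<Rightarrow> ('a \<Rightarrow> 'a) \<Rightarrow> complex \<Rightarrow> 'a \<Rightarrow> bool"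
  where "eigenvector_on D A c x \<longleftrightarrow> x \<in> D \<and> x \<noteq> 0 \<and> A x = c *\<^sub>C x"


section \<open>The exponential of a bounded operator\<close>

definition blinfun_power :: "('a::real_normed_vector \<Rightarrow>\<^sub>L 'a) \<Rightarrow> nat \<Rightarrow> ('a \<Rightarrow>\<^sub>L 'a)"
  where "blinfun_power A n = (((o\<^sub>L) A) ^^ n) id_blinfun"

definition blinfun_exp :: "('a::banach \<Rightarrow>\<^sub>L 'a) \<Rightarrow> ('a \<Rightarrow>\<^sub>L 'a)"
  where "blinfun_exp A = (\<Sum>n. (1 / fact n) *\<^sub>R blinfun_power A n)"

lemma norm_blinfun_power_le: "norm (blinfun_power A n) \<le> norm A ^ n"
proof (induction n)
  case 0
  then show ?case by (simp add: blinfun_power_def norm_blinfun_id_le)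
next
  case (Suc n)
  have "norm (blinfun_power A (Suc n)) \<le> norm A * norm (blinfun_power A n)"
    by (simp add: blinfun_power_def norm_blinfun_compose)
  also have "\<dots> \<le> norm A * norm A ^ n"
    by (rule mult_left_mono[OF Suc.IH]) simp
  finally show ?case by simp
qed

lemma summable_blinfun_exp:
  fixes A :: "'a::banach \<Rightarrow>\<^sub>L 'a"
  shows "summable (\<lambda>n. (1 / fact n) *\<^sub>R blinfun_power A n)"
proof (rule summable_comparison_test')
  show "summable (\<lambda>n. inverse (fact n) * norm A ^ n)"
    by (rule summable_exp)
  show "norm ((1 / fact n) *\<^sub>R blinfun_power A n) \<le> inverse (fact n) * norm A ^ n"
    if "n \<ge> 0" for n
    using norm_blinfun_power_le[of A n] by (simp add: field_simps)
qed


section \<open>The space of complex null sequences\<close>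

text \<open>The paper's sequences are indexed from 1: the \<open>k\<close>-th entry of \<open>a\<close> is \<open>c0_seq a (k - 1)\<close>.\<close>

typedef c0 = "{a :: nat \<Rightarrow> complex. a \<longlonglongrightarrow> 0}"
  morphisms c0_seq Abs_c0
  by (rule exI[of _ "\<lambda>_. 0"]) simp

setup_lifting type_definition_c0

lemma c0_eqI: "(\<And>n. c0_seq a n = c0_seq b n) \<Longrightarrow> a = b"
  by (metis c0_seq_inject ext)

lemma c0_seq_tendsto: "c0_seq a \<longlonglongrightarrow> 0"
  using c0_seq[of a] by simp

lemma c0_seq_bdd: "bdd_above (range (\<lambda>n. cmod (c0_seq a n)))"
proof -
  have "Bseq (c0_seq a)"
    using c0_seq_tendsto convergentI convergent_imp_Bseq by blast
  then show ?thesis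
    unfolding Bseq_def bdd_above_def by auto
qed

instantiation c0 :: real_vector
begin

lift_definition zero_c0 :: c0 is "\<lambda>_. 0" by simp
lift_definition plus_c0 :: "c0 \<Rightarrow> c0 \<Rightarrow> c0" is "\<lambda>a b n. a n + b n"
  by (rule tendsto_add_zero)
lift_definition minus_c0 :: "c0 \<Rightarrow> c0 \<Rightarrow> c0" is "\<lambda>a b n. a n - b n"
  using tendsto_diff by fastforce
lift_definition uminus_c0 :: "c0 \<Rightarrow> c0" is "\<lambda>a n. - a n"
  using tendsto_minus by fastforce
lift_definition scaleR_c0 :: "real \<Rightarrow> c0 \<Rightarrow> c0" is "\<lambda>r a n. complex_of_real r * a n"
  by (rule tendsto_mult_right_zero)

instance
proof
  fix a b c :: c0 and r s :: real
  show "a + b + c = a + (b + c)" by (rule c0_eqI) (simp add: plus_c0.rep_eq)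
  show "a + b = b + a" by (rule c0_eqI) (simp add: plus_c0.rep_eq)
  show "0 + a = a" by (rule c0_eqI) (simp add: plus_c0.rep_eq zero_c0.rep_eq)
  show "- a + a = 0"
    by (rule c0_eqI) (simp add: plus_c0.rep_eq zero_c0.rep_eq uminus_c0.rep_eq)
  show "a - b = a + - b"
    by (rule c0_eqI) (simp add: plus_c0.rep_eq minus_c0.rep_eq uminus_c0.rep_eq)
  show "r *\<^sub>R (a + b) = r *\<^sub>R a + r *\<^sub>R b"
    by (rule c0_eqI) (simp add: plus_c0.rep_eq scaleR_c0.rep_eq algebra_simps)
  show "(r + s) *\<^sub>R a = r *\<^sub>R a + s *\<^sub>R a"
    by (rule c0_eqI) (simp add: plus_c0.rep_eq scaleR_c0.rep_eq algebra_simps)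
  show "r *\<^sub>R s *\<^sub>R a = (r * s) *\<^sub>R a" by (rule c0_eqI) (simp add: scaleR_c0.rep_eq)
  show "1 *\<^sub>R a = a" by (rule c0_eqI) (simp add: scaleR_c0.rep_eq)
qed

end

instantiation c0 :: real_normed_vector
begin

definition norm_c0 :: "c0 \<Rightarrow> real"
  where "norm_c0 a = (SUP n. cmod (c0_seq a n))"
definition dist_c0 :: "c0 \<Rightarrow> c0 \<Rightarrow> real"
  where "dist_c0 a b = norm (a - b)"
definition sgn_c0 :: "c0 \<Rightarrow> c0"
  where "sgn_c0 a = a /\<^sub>R norm a"
definition uniformity_c0 :: "(c0 \<times> c0) filter"
  where "uniformity_c0 = (INF e\<in>{0 <..}. principal {(x, y). dist x y < e})"
definition open_c0 :: "c0 set \<Rightarrow> bool"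
  where "open_c0 U \<longleftrightarrow> (\<forall>x\<in>U. eventually (\<lambda>(x', y). x' = x \<longrightarrow> y \<in> U) uniformity)"

lemma c0_norm_ge: "cmod (c0_seq a n) \<le> norm a"
  unfolding norm_c0_def by (rule cSUP_upper[OF _ c0_seq_bdd]) simp

lemma c0_norm_le: "(\<And>n. cmod (c0_seq a n) \<le> B) \<Longrightarrow> norm a \<le> B"
  unfolding norm_c0_def by (rule cSUP_least) auto

lemma c0_norm_ge_0: "0 \<le> norm (a :: c0)"
  using c0_norm_ge[of a 0] norm_ge_zero order_trans by blast

instance
proof
  fix a b :: c0 and r :: real and U :: "c0 set"
  show "dist a b = norm (a - b)" by (rule dist_c0_def)
  show "sgn a = a /\<^sub>R norm a" by (rule sgn_c0_def)
  show "(uniformity :: (c0 \<times> c0) filter) = (INF e\<in>{0 <..}. principal {(x, y). dist x y < e})"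
    by (rule uniformity_c0_def)
  show "open U \<longleftrightarrow> (\<forall>x\<in>U. eventually (\<lambda>(x', y). x' = x \<longrightarrow> y \<in> U) uniformity)"
    by (rule open_c0_def)
  show "norm a = 0 \<longleftrightarrow> a = 0"
  proof
    assume "norm a = 0"
    then show "a = 0"
      using c0_norm_ge[of a] by (intro c0_eqI) (simp add: zero_c0.rep_eq)
  next
    assume "a = 0"
    then show "norm a = 0" by (simp add: norm_c0_def zero_c0.rep_eq)
  qed
  show "norm (a + b) \<le> norm a + norm b"
  proof (rule c0_norm_le)
    fix n
    show "cmod (c0_seq (a + b) n) \<le> norm a + norm b"
      using c0_norm_ge[of a n] c0_norm_ge[of b n] norm_triangle_ineq[of "c0_seq a n" "c0_seq b n"]
      by (simp add: plus_c0.rep_eq)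
  qed
  have le: "norm (r *\<^sub>R a) \<le> \<bar>r\<bar> * norm a" for r :: real and a :: c0
    by (rule c0_norm_le) (simp add: scaleR_c0.rep_eq norm_mult c0_norm_ge mult_left_mono)
  show "norm (r *\<^sub>R a) = \<bar>r\<bar> * norm a"
  proof (cases "r = 0")
    case True
    then show ?thesis using le[of r a] c0_norm_ge_0[of "r *\<^sub>R a"] by simp
  next
    case False
    have "inverse r *\<^sub>R (r *\<^sub>R a) = a"
      using False by (intro c0_eqI) (simp add: scaleR_c0.rep_eq)
    then have "norm a \<le> \<bar>inverse r\<bar> * norm (r *\<^sub>R a)"
      using le[of "inverse r" "r *\<^sub>R a"] by simp
    then have "\<bar>r\<bar> * norm a \<le> norm (r *\<^sub>R a)"
      using False by (simp add: field_simps)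
    then show ?thesis using le[of r a] by simp
  qed
qed

end

instance c0 :: banach
proof
  fix X :: "nat \<Rightarrow> c0"
  assume X: "Cauchy X"
  have "Cauchy (\<lambda>i. c0_seq (X i) n)" for n
  proof (rule metric_CauchyI)
    fix r :: real assume "r > 0"
    then obtain M where M: "\<forall>i\<ge>M. \<forall>j\<ge>M. dist (X i) (X j) < r"
      using metric_CauchyD[OF X] by blast
    have "dist (c0_seq (X i) n) (c0_seq (X j) n) \<le> dist (X i) (X j)" for i j
      using c0_norm_ge[of "X i - X j" n] by (simp add: dist_norm minus_c0.rep_eq)
    then show "\<exists>M. \<forall>i\<ge>M. \<forall>j\<ge>M. dist (c0_seq (X i) n) (c0_seq (X j) n) < r"
      using M by (meson le_less_trans)
  qed
  then obtain L where L: "\<And>n. (\<lambda>i. c0_seq (X i) n) \<longlonglongrightarrow> L n"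
    unfolding Cauchy_convergent_iff convergent_def by metis
  have unif: "\<exists>M. \<forall>i\<ge>M. \<forall>n. cmod (c0_seq (X i) n - L n) \<le> r" if r: "r > 0" for r
  proof -
    obtain M where M: "\<And>i j. i \<ge> M \<Longrightarrow> j \<ge> M \<Longrightarrow> dist (X i) (X j) < r"
      using metric_CauchyD[OF X r] by blast
    have "cmod (c0_seq (X i) n - L n) \<le> r" if i: "i \<ge> M" for i n
    proof (rule tendsto_upperbound)
      show "(\<lambda>j. cmod (c0_seq (X i) n - c0_seq (X j) n)) \<longlonglongrightarrow> cmod (c0_seq (X i) n - L n)"
        by (intro tendsto_intros L)
      have "cmod (c0_seq (X i) n - c0_seq (X j) n) \<le> r" if "j \<ge> M" for j
        using c0_norm_ge[of "X i - X j" n] M[OF i that] by (simp add: dist_norm minus_c0.rep_eq)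
      then show "\<forall>\<^sub>F j in sequentially. cmod (c0_seq (X i) n - c0_seq (X j) n) \<le> r"
        by (auto simp: eventually_sequentially)
    qed simp
    then show ?thesis by blast
  qed
  have "L \<longlonglongrightarrow> 0"
  proof (rule LIMSEQ_I)
    fix r :: real assume r: "r > 0"
    then obtain M where M: "\<And>n. cmod (c0_seq (X M) n - L n) \<le> r / 2"
      using unif[of "r / 2"] by auto
    obtain N where N: "\<And>n. n \<ge> N \<Longrightarrow> cmod (c0_seq (X M) n) < r / 2"
      using LIMSEQ_D[OF c0_seq_tendsto[of "X M"], of "r / 2"] r by auto
    have "norm (L n - 0) < r" if "n \<ge> N" for n
      using M[of n] N[OF that] norm_triangle_ineq4[of "c0_seq (X M) n" "c0_seq (X M) n - L n"] by simp
    then show "\<exists>N. \<forall>n\<ge>N. norm (L n - 0) < r" by blast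
  qed
  then have L': "c0_seq (Abs_c0 L) = L" by (simp add: Abs_c0_inverse)
  have "X \<longlonglongrightarrow> Abs_c0 L"
  proof (rule LIMSEQ_I)
    fix r :: real assume r: "r > 0"
    then obtain M where M: "\<And>i n. i \<ge> M \<Longrightarrow> cmod (c0_seq (X i) n - L n) \<le> r / 2"
      using unif[of "r / 2"] by auto
    have "norm (X i - Abs_c0 L) \<le> r / 2" if "i \<ge> M" for i
      by (rule c0_norm_le) (simp only: minus_c0.rep_eq L' M[OF that])
    moreover have "r / 2 < r" using r by simp
    ultimately show "\<exists>M. \<forall>i\<ge>M. norm (X i - Abs_c0 L) < r"
      by (meson le_less_trans)
  qed
  then show "convergent X" by (rule convergentI)
qed

instantiation c0 :: complex_banach
begin

lift_definition scaleC_c0 :: "complex \<Rightarrow> c0 \<Rightarrow> c0" is "\<lambda>c a n. c * a n"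
  by (rule tendsto_mult_right_zero)

instance
proof
  fix a b :: c0 and c d :: complex and r :: real
  show "c *\<^sub>C (a + b) = c *\<^sub>C a + c *\<^sub>C b"
    by (rule c0_eqI) (simp add: plus_c0.rep_eq scaleC_c0.rep_eq algebra_simps)
  show "(c + d) *\<^sub>C a = c *\<^sub>C a + d *\<^sub>C a"
    by (rule c0_eqI) (simp add: plus_c0.rep_eq scaleC_c0.rep_eq algebra_simps)
  show "c *\<^sub>C d *\<^sub>C a = (c * d) *\<^sub>C a" by (rule c0_eqI) (simp add: scaleC_c0.rep_eq)
  show "1 *\<^sub>C a = a" by (rule c0_eqI) (simp add: scaleC_c0.rep_eq)
  show "r *\<^sub>R a = complex_of_real r *\<^sub>C a"
    by (rule c0_eqI) (simp add: scaleC_c0.rep_eq scaleR_c0.rep_eq)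
  have "c0_seq (c *\<^sub>C a) n = c * c0_seq a n" for n
    by (simp add: scaleC_c0.rep_eq)
  then have "norm (c *\<^sub>C a) = norm (cmod c *\<^sub>R a)"
    unfolding norm_c0_def by (simp add: scaleR_c0.rep_eq norm_mult)
  then show "norm (c *\<^sub>C a) = cmod c * norm a" by simp
qed

end

text \<open>\<open>unit_vec k\<close> is the paper's \<open>e\<^sub>k\<close> for \<open>k \<ge> 1\<close>; \<open>unit_vec 0 = 0\<close> is not used.\<close>

lift_definition unit_vec :: "nat \<Rightarrow> c0" is "\<lambda>k n. if Suc n = k then 1 else 0"
proof -
  fix k :: nat
  have "\<forall>\<^sub>F n in sequentially. (if Suc n = k then 1 else 0 :: complex) = 0"
    by (rule eventually_sequentiallyI[of k]) simp
  then show "(\<lambda>n. if Suc n = k then 1 else 0 :: complex) \<longlonglongrightarrow> 0"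
    by (rule tendsto_eventually)
qed

text \<open>The functional on \<open>c0\<close> given by an absolutely summable sequence \<open>b\<close> (no conjugation);
  this is the identification of \<open>\<ell>\<^sub>1\<close> with the dual of \<open>c0\<close>.\<close>

definition l1_functional :: "(nat \<Rightarrow> complex) \<Rightarrow> (c0 \<Rightarrow>\<^sub>L complex)"
  where "l1_functional b = Blinfun (\<lambda>a. \<Sum>n. c0_seq a n * b n)"

lemma l1_functional_apply:
  assumes b: "summable (\<lambda>n. cmod (b n))"
  shows "blinfun_apply (l1_functional b) a = (\<Sum>n. c0_seq a n * b n)"
proof -
  have bound: "norm (c0_seq x n * b n) \<le> norm x * cmod (b n)" for x n
    by (simp add: norm_mult c0_norm_ge mult_right_mono)
  have sn: "summable (\<lambda>n. norm (c0_seq x n * b n))" for x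
    by (rule summable_comparison_test'[OF summable_mult[OF b, of "norm x"]]) (use bound in auto)
  have s: "summable (\<lambda>n. c0_seq x n * b n)" for x
    by (rule summable_norm_cancel[OF sn])
  have "bounded_linear (\<lambda>x. \<Sum>n. c0_seq x n * b n)"
  proof (rule bounded_linear_intro)
    fix x y :: c0 and r :: real
    show "(\<Sum>n. c0_seq (x + y) n * b n) = (\<Sum>n. c0_seq x n * b n) + (\<Sum>n. c0_seq y n * b n)"
      using suminf_add[OF s s] by (simp add: plus_c0.rep_eq algebra_simps)
    show "(\<Sum>n. c0_seq (r *\<^sub>R x) n * b n) = r *\<^sub>R (\<Sum>n. c0_seq x n * b n)"
      using suminf_mult[OF s, of "complex_of_real r"]
      by (simp add: scaleR_c0.rep_eq scaleR_conv_of_real mult.assoc)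
    have "norm (\<Sum>n. c0_seq x n * b n) \<le> (\<Sum>n. norm (c0_seq x n * b n))"
      by (rule summable_norm[OF sn])
    also have "\<dots> \<le> (\<Sum>n. norm x * cmod (b n))"
      by (rule suminf_le[OF bound sn summable_mult[OF b]])
    also have "\<dots> = norm x * (\<Sum>n. cmod (b n))"
      by (rule suminf_mult[OF b])
    finally show "norm (\<Sum>n. c0_seq x n * b n) \<le> norm x * (\<Sum>n. cmod (b n))" .
  qed
  then show ?thesis
    by (simp add: l1_functional_def bounded_linear_Blinfun_apply)
qed


section \<open>The operator\<close>

text \<open>The series over \<open>k \<ge> 2\<close> converges in the norm of \<open>c0\<close>; its terms are enumerated by
  \<open>k = n + 2\<close>.\<close>

definition determining_conditions :: "(c0 \<Rightarrow>\<^sub>L c0) \<Rightarrow> bool"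
  where "determining_conditions A \<longleftrightarrow>
    clinear A \<and>
    (\<lambda>n. complex_of_real (1 / real (n + 2)) *\<^sub>C unit_vec (n + 2))
      sums blinfun_apply A (unit_vec 1) \<and>
    (\<forall>i\<ge>2. blinfun_apply A (unit_vec i) = complex_of_real (- (1 / real i)) *\<^sub>C unit_vec i)"

end

theory Submission
  imports Defs
begin

text \<open>
  With indices shifted to start at 0, the operator has the coordinate form
  \<open>(A a)\<^sub>n = (a\<^sub>0 - a\<^sub>n) / (n + 1)\<close>; no separate clause for \<open>n = 0\<close> is needed, because the
  formula gives 0 there.  Thus \<open>A\<close> annihilates the first coordinate and multiplies
  each difference \<open>a\<^sub>n - a\<^sub>0\<close> by \<open>-1 / (n + 1)\<close>.  The exponential series is therefore scalar in
  each coordinate, and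
    \<open>(T\<^sub>t a)\<^sub>n = a\<^sub>0 + exp (- t / (n + 1)) (a\<^sub>n - a\<^sub>0)\<close>   (\<open>exp_relaxation_nth\<close>).
  In other words, each coordinate relaxes to the first one at its own rate \<open>1 / (n + 1)\<close>.

  This formula carries the theorem.  Its right-hand side is a convex combination of \<open>a\<^sub>0\<close> and
  \<open>a\<^sub>n\<close>, so \<open>T\<^sub>t\<close> is a contraction; the first coordinate is constant in time, which gives
  \<open>\<langle>T\<^sub>t e\<^sub>1, e\<^sub>1\<^sup>*\<rangle> = 1\<close>; and since all rates lie in \<open>(0, 1]\<close>, elementary estimates of the scalar
  exponential are uniform in the coordinate and give strong continuity and the generator.

  An eigenvector for 0 would be a constant sequence, and the only constant null sequence is 0; this
  is the point at which the choice of \<open>c\<^sub>0\<close> matters.  For any other purely imaginary eigenvalue the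
  first coordinate vanishes, and then so do all the others, because \<open>-1 / (n + 1)\<close> is not
  imaginary.  Finally, \<open>A\<close> is determined by its values on the unit vectors because these form a
  Schauder basis (\<open>unit_vec_expansion\<close>).
\<close>


section \<open>Coordinates and the unit vector basis\<close>

lemma unit_vec_nth: "c0_seq (unit_vec k) n = (if Suc n = k then 1 else 0)"
  by (simp add: unit_vec.rep_eq)

lemma bounded_linear_c0_seq: "bounded_linear (\<lambda>a. c0_seq a n)"
  by (rule bounded_linear_intro[where K = 1])
     (simp_all add: plus_c0.rep_eq scaleR_c0.rep_eq scaleR_conv_of_real c0_norm_ge)

lemma c0_seq_sum: "c0_seq (sum f I) n = (\<Sum>i\<in>I. c0_seq (f i) n)"
  by (rule linear_sum[OF bounded_linear.linear[OF bounded_linear_c0_seq]])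

lemma norm_unit_vec_Suc: "norm (unit_vec (Suc k)) = 1"
proof (rule antisym)
  show "norm (unit_vec (Suc k)) \<le> 1"
    by (rule c0_norm_le) (simp add: unit_vec_nth)
  show "1 \<le> norm (unit_vec (Suc k))"
    using c0_norm_ge[of "unit_vec (Suc k)" k] by (simp add: unit_vec_nth)
qed

text \<open>The remainder after \<open>N\<close> terms is the tail of \<open>a\<close>, and its supremum norm is small precisely
  because \<open>a\<close> is a null sequence.\<close>

lemma unit_vec_expansion: "(\<lambda>n. c0_seq a n *\<^sub>C unit_vec (Suc n)) sums a"
  unfolding sums_def
proof (rule LIMSEQ_I)
  fix r :: real assume r: "r > 0"
  obtain N where N: "\<And>n. n \<ge> N \<Longrightarrow> cmod (c0_seq a n) < r / 2"
    using LIMSEQ_D[OF c0_seq_tendsto[of a], of "r / 2"] r by auto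
  have "norm ((\<Sum>n<M. c0_seq a n *\<^sub>C unit_vec (Suc n)) - a) \<le> r / 2" if "M \<ge> N" for M
  proof (rule c0_norm_le)
    fix m
    have "c0_seq (\<Sum>n<M. c0_seq a n *\<^sub>C unit_vec (Suc n)) m
        = (\<Sum>n<M. if n = m then c0_seq a m else 0)"
      unfolding c0_seq_sum by (rule sum.cong) (auto simp: scaleC_c0.rep_eq unit_vec_nth)
    also have "\<dots> = (if m < M then c0_seq a m else 0)"
      by simp
    finally show "cmod (c0_seq ((\<Sum>n<M. c0_seq a n *\<^sub>C unit_vec (Suc n)) - a) m) \<le> r / 2"
      using N[of m] that r by (auto simp: minus_c0.rep_eq)
  qed
  moreover have "r / 2 < r" using r by simp
  ultimately show "\<exists>N. \<forall>M\<ge>N. norm ((\<Sum>n<M. c0_seq a n *\<^sub>C unit_vec (Suc n)) - a) < r"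
    by (meson le_less_trans)
qed

lemma unit_vec_expansion_from_2:
  assumes "c0_seq a 0 = 0"
  shows "(\<lambda>n. c0_seq a (Suc n) *\<^sub>C unit_vec (n + 2)) sums a"
proof -
  have "c0_seq a 0 *\<^sub>C unit_vec (Suc 0) = 0"
    using assms by (intro c0_eqI) (simp add: scaleC_c0.rep_eq zero_c0.rep_eq)
  then show ?thesis
    using unit_vec_expansion[of a] sums_Suc_iff[of "\<lambda>n. c0_seq a n *\<^sub>C unit_vec (Suc n)" a]
    by simp
qed

lemma clinear_eq_on_unit_vec:
  fixes A B :: "c0 \<Rightarrow>\<^sub>L c0"
  assumes "clinear A" "clinear B"
    and eq: "\<And>n. blinfun_apply A (unit_vec (Suc n)) = blinfun_apply B (unit_vec (Suc n))"
  shows "A = B"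
proof (rule blinfun_eqI)
  fix a
  have "(\<lambda>n. c0_seq a n *\<^sub>C blinfun_apply C (unit_vec (Suc n))) sums blinfun_apply C a"
    if "clinear C" for C :: "c0 \<Rightarrow>\<^sub>L c0"
    using bounded_linear.sums[OF blinfun.bounded_linear_right unit_vec_expansion[of a], of C] that
    by (simp add: clinear_def)
  from this[OF assms(1)] this[OF assms(2)] show "blinfun_apply A a = blinfun_apply B a"
    unfolding eq by (rule sums_unique2)
qed


section \<open>The operator in coordinates\<close>

lift_definition relaxation_map :: "c0 \<Rightarrow> c0"
  is "\<lambda>a n. (a 0 - a n) / complex_of_real (real (Suc n))"
proof -
  fix a :: "nat \<Rightarrow> complex"
  assume "a \<longlonglongrightarrow> 0"
  then have "(\<lambda>n. (a 0 - a n) * complex_of_real (inverse (real (Suc n))))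
      \<longlonglongrightarrow> (a 0 - 0) * complex_of_real 0"
    by (intro tendsto_mult tendsto_diff tendsto_const tendsto_of_real LIMSEQ_inverse_real_of_nat)
  then show "(\<lambda>n. (a 0 - a n) / complex_of_real (real (Suc n))) \<longlonglongrightarrow> 0"
    by (simp add: divide_inverse)
qed

definition relaxation :: "c0 \<Rightarrow>\<^sub>L c0"
  where "relaxation = Blinfun relaxation_map"

lemma c0_seq_diff_le: "cmod (c0_seq a n - c0_seq a m) \<le> 2 * norm a"
  using norm_triangle_ineq4[of "c0_seq a n" "c0_seq a m"] c0_norm_ge[of a n] c0_norm_ge[of a m]
  by linarith

lemma bounded_linear_relaxation_map: "bounded_linear relaxation_map"
proof (rule bounded_linear_intro[where K = 2])
  fix a b :: c0 and r :: real
  show "relaxation_map (a + b) = relaxation_map a + relaxation_map b"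
    by (rule c0_eqI) (simp add: relaxation_map.rep_eq plus_c0.rep_eq add_divide_distrib[symmetric]
        del: of_nat_Suc)
  show "relaxation_map (r *\<^sub>R a) = r *\<^sub>R relaxation_map a"
    by (rule c0_eqI) (simp add: relaxation_map.rep_eq scaleR_c0.rep_eq right_diff_distrib
        del: of_nat_Suc)
  show "norm (relaxation_map a) \<le> norm a * 2"
  proof (rule c0_norm_le)
    fix n
    have "cmod (c0_seq (relaxation_map a) n) = cmod (c0_seq a 0 - c0_seq a n) / real (Suc n)"
      by (simp add: relaxation_map.rep_eq norm_divide del: of_nat_Suc)
    also have "\<dots> \<le> cmod (c0_seq a 0 - c0_seq a n) / 1"
      by (rule divide_left_mono) auto
    also have "\<dots> \<le> norm a * 2"
      using c0_seq_diff_le[of a 0 n] by simp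
    finally show "cmod (c0_seq (relaxation_map a) n) \<le> norm a * 2" .
  qed
qed

lemma relaxation_nth:
  "c0_seq (blinfun_apply relaxation a) n
    = (c0_seq a 0 - c0_seq a n) / complex_of_real (real (Suc n))"
  by (simp add: relaxation_def bounded_linear_Blinfun_apply[OF bounded_linear_relaxation_map]
      relaxation_map.rep_eq)

lemma relaxation_unit_vec:
  assumes "i \<ge> 2"
  shows "blinfun_apply relaxation (unit_vec i) = complex_of_real (- (1 / real i)) *\<^sub>C unit_vec i"
  using assms by (intro c0_eqI) (auto simp: relaxation_nth unit_vec_nth scaleC_c0.rep_eq)

lemma determining_conditions_relaxation: "determining_conditions relaxation"
  unfolding determining_conditions_def
proof (intro conjI allI impI relaxation_unit_vec)
  show "clinear relaxation"
    unfolding clinear_def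
    by (intro allI c0_eqI) (simp add: relaxation_nth scaleC_c0.rep_eq right_diff_distrib)
  show "(\<lambda>n. complex_of_real (1 / real (n + 2)) *\<^sub>C unit_vec (n + 2))
      sums blinfun_apply relaxation (unit_vec 1)"
    using unit_vec_expansion_from_2[of "blinfun_apply relaxation (unit_vec 1)"]
    by (simp add: relaxation_nth unit_vec_nth)
qed

lemma determining_conditions_iff: "determining_conditions A \<longleftrightarrow> A = relaxation"
proof
  assume A: "determining_conditions A"
  show "A = relaxation"
  proof (rule clinear_eq_on_unit_vec)
    show "clinear A" "clinear relaxation"
      using A determining_conditions_relaxation by (simp_all add: determining_conditions_def)
    fix n
    show "blinfun_apply A (unit_vec (Suc n)) = blinfun_apply relaxation (unit_vec (Suc n))"
    proof (cases n)
      case 0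
      then show ?thesis
        using A determining_conditions_relaxation sums_unique2
        unfolding determining_conditions_def by (metis One_nat_def)
    next
      case (Suc m)
      then show ?thesis
        using A relaxation_unit_vec[of "Suc n"] by (simp add: determining_conditions_def)
    qed
  qed
qed (simp add: determining_conditions_relaxation)

lemma relaxation_no_imaginary_eigenvalue:
  assumes c: "Re c = 0" and eig: "blinfun_apply relaxation y = c *\<^sub>C y"
  shows "y = 0"
proof -
  have *: "c0_seq y 0 - c0_seq y n = c * c0_seq y n * complex_of_real (real (Suc n))" for n
  proof -
    have "(c0_seq y 0 - c0_seq y n) / complex_of_real (real (Suc n)) = c * c0_seq y n"
      using arg_cong[OF eig, of "\<lambda>z. c0_seq z n"] by (simp add: relaxation_nth scaleC_c0.rep_eq)
    then show ?thesis
      by (metis nonzero_divide_eq_eq of_nat_eq_0_iff of_real_eq_0_iff nat.distinct(2))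
  qed
  have "c0_seq y 0 = 0"
  proof (cases "c = 0")
    case True
    then have "c0_seq y = (\<lambda>_. c0_seq y 0)"
      using * by (simp add: fun_eq_iff eq_commute[of "c0_seq y 0"])
    then show ?thesis
      using c0_seq_tendsto[of y] by (metis LIMSEQ_const_iff)
  next
    case False
    then show ?thesis using *[of 0] by simp
  qed
  have "c0_seq y n = 0" for n
  proof -
    have "(c * complex_of_real (real (Suc n)) + 1) * c0_seq y n
        = c * c0_seq y n * complex_of_real (real (Suc n)) - (0 - c0_seq y n)"
      by (simp add: algebra_simps)
    also have "\<dots> = 0"
      unfolding *[of n, symmetric] \<open>c0_seq y 0 = 0\<close> by simp
    finally have "(c * complex_of_real (real (Suc n)) + 1) * c0_seq y n = 0" .
    moreover have "Re (c * complex_of_real (real (Suc n)) + 1) \<noteq> 0"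
      using c by simp
    ultimately show ?thesis
      by (metis mult_eq_0_iff zero_complex.sel(1))
  qed
  then show ?thesis by (intro c0_eqI) (simp add: zero_c0.rep_eq)
qed


section \<open>The semigroup in coordinates\<close>

lemma blinfun_power_scaleR: "blinfun_power (t *\<^sub>R A) m = t ^ m *\<^sub>R blinfun_power A m"
  by (induction m)
     (simp_all add: blinfun_power_def mult.commute
        bounded_bilinear.scaleR_left[OF bounded_bilinear_blinfun_compose]
        bounded_bilinear.scaleR_right[OF bounded_bilinear_blinfun_compose])

text \<open>The first summand accounts for the power 0, where the part \<open>a\<^sub>0\<close> has not yet been
  annihilated.\<close>

lemma relaxation_power_nth:
  "c0_seq (blinfun_apply (blinfun_power relaxation m) a) n
    = (if m = 0 then c0_seq a 0 else 0)
      + complex_of_real ((- 1 / real (Suc n)) ^ m) * (c0_seq a n - c0_seq a 0)"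
proof (induction m arbitrary: n)
  case 0
  show ?case by (simp add: blinfun_power_def)
next
  case (Suc m)
  have "c0_seq (blinfun_apply (blinfun_power relaxation (Suc m)) a) n
      = (c0_seq (blinfun_apply (blinfun_power relaxation m) a) 0
          - c0_seq (blinfun_apply (blinfun_power relaxation m) a) n)
        / complex_of_real (real (Suc n))"
    by (simp add: blinfun_power_def relaxation_nth)
  also have "\<dots> = - (complex_of_real ((- 1 / real (Suc n)) ^ m) * (c0_seq a n - c0_seq a 0))
        / complex_of_real (real (Suc n))"
    by (simp only: Suc.IH) simp
  finally show ?case
    by simp
qed

lemma exp_relaxation_nth:
  "c0_seq (blinfun_apply (blinfun_exp (t *\<^sub>R relaxation)) a) n
    = c0_seq a 0 + complex_of_real (exp (- t / real (Suc n))) * (c0_seq a n - c0_seq a 0)"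
proof -
  define q where "q = - t / real (Suc n)"
  have "(\<lambda>m. (1 / fact m) *\<^sub>R blinfun_power (t *\<^sub>R relaxation) m)
      sums blinfun_exp (t *\<^sub>R relaxation)"
    unfolding blinfun_exp_def by (rule summable_sums[OF summable_blinfun_exp])
  then have "(\<lambda>m. c0_seq (blinfun_apply ((1 / fact m) *\<^sub>R blinfun_power (t *\<^sub>R relaxation) m) a) n)
      sums c0_seq (blinfun_apply (blinfun_exp (t *\<^sub>R relaxation)) a) n"
    by (intro bounded_linear.sums[OF bounded_linear_c0_seq]
        bounded_linear.sums[OF blinfun.bounded_linear_left])
  moreover have "q ^ m = t ^ m * (- 1 / real (Suc n)) ^ m" for m
    by (simp add: q_def power_mult_distrib[symmetric] del: of_nat_Suc)
  then have "c0_seq (blinfun_apply ((1 / fact m) *\<^sub>R blinfun_power (t *\<^sub>R relaxation) m) a) n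
      = (if m = 0 then c0_seq a 0 else 0)
        + complex_of_real (q ^ m /\<^sub>R fact m) * (c0_seq a n - c0_seq a 0)" for m
    by (simp add: blinfun_power_scaleR blinfun.scaleR_left scaleR_c0.rep_eq relaxation_power_nth
        divide_inverse distrib_left del: of_nat_Suc)
  moreover have "(\<lambda>m. (if m = 0 then c0_seq a 0 else 0)
        + complex_of_real (q ^ m /\<^sub>R fact m) * (c0_seq a n - c0_seq a 0))
      sums (c0_seq a 0 + complex_of_real (exp q) * (c0_seq a n - c0_seq a 0))"
    by (intro sums_add sums_mult2 sums_of_real exp_converges sums_single)
  ultimately show ?thesis
    unfolding q_def using sums_unique2 by simp
qed

lemma norm_exp_relaxation_le:
  assumes "t \<ge> 0"
  shows "norm (blinfun_exp (t *\<^sub>R relaxation)) \<le> 1"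
proof (rule norm_blinfun_bound)
  fix a
  show "norm (blinfun_apply (blinfun_exp (t *\<^sub>R relaxation)) a) \<le> 1 * norm a"
  proof (rule c0_norm_le)
    fix n
    define q where "q = exp (- t / real (Suc n))"
    have q: "0 \<le> q" "q \<le> 1"
      using assms by (auto simp: q_def)
    have "c0_seq (blinfun_apply (blinfun_exp (t *\<^sub>R relaxation)) a) n
        = complex_of_real (1 - q) * c0_seq a 0 + complex_of_real q * c0_seq a n"
      by (simp add: exp_relaxation_nth q_def algebra_simps)
    then have "cmod (c0_seq (blinfun_apply (blinfun_exp (t *\<^sub>R relaxation)) a) n)
        \<le> (1 - q) * cmod (c0_seq a 0) + q * cmod (c0_seq a n)"
      using q norm_triangle_ineq[of "complex_of_real (1 - q) * c0_seq a 0"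
          "complex_of_real q * c0_seq a n"]
      by (simp add: norm_mult del: of_real_diff)
    also have "\<dots> \<le> (1 - q) * norm a + q * norm a"
      using q by (intro add_mono mult_left_mono c0_norm_ge) auto
    finally show "cmod (c0_seq (blinfun_apply (blinfun_exp (t *\<^sub>R relaxation)) a) n) \<le> 1 * norm a"
      by (simp add: algebra_simps)
  qed
qed simp

lemma abs_exp_minus_diff_le:
  fixes x y :: real
  assumes "0 \<le> x" "0 \<le> y"
  shows "\<bar>exp (- x) - exp (- y)\<bar> \<le> \<bar>x - y\<bar>"
proof -
  have *: "exp (- u) - exp (- v) \<le> v - u" if "0 \<le> u" "u \<le> v" for u v :: real
  proof -
    have "exp (- u) - exp (- v) = exp (- u) * (1 - exp (- (v - u)))"
      by (simp add: algebra_simps exp_add[symmetric])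
    also have "\<dots> \<le> 1 * (v - u)"
    proof (rule mult_mono)
      show "1 - exp (- (v - u)) \<le> v - u"
        using exp_ge_add_one_self[of "- (v - u)"] by linarith
    qed (use that in auto)
    finally show ?thesis by simp
  qed
  show ?thesis
    using *[of x y] *[of y x] assms by (cases "x \<le> y") auto
qed

lemma exp_minus_second_order:
  fixes x :: real
  assumes "0 \<le> x"
  shows "\<bar>exp (- x) - 1 + x\<bar> \<le> x\<^sup>2"
proof -
  have "exp (- x) \<le> 1 / (1 + x)"
    using exp_ge_add_one_self[of x] assms by (simp add: exp_minus field_simps)
  also have "1 / (1 + x) \<le> 1 - x + x\<^sup>2"
    using assms by (simp add: field_simps power2_eq_square)
  finally show ?thesis
    using exp_ge_add_one_self[of "- x"] by simp
qed

lemma rate_le: "0 \<le> t \<Longrightarrow> t / real (Suc n) \<le> t"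
  using divide_left_mono[of 1 "real (Suc n)" t] by simp

lemma exp_relaxation_lipschitz:
  assumes "0 \<le> s" "0 \<le> t"
  shows "norm (blinfun_apply (blinfun_exp (s *\<^sub>R relaxation)) a
      - blinfun_apply (blinfun_exp (t *\<^sub>R relaxation)) a) \<le> 2 * norm a * \<bar>s - t\<bar>"
proof (rule c0_norm_le)
  fix n
  define u where "u = \<bar>exp (- (s / real (Suc n))) - exp (- (t / real (Suc n)))\<bar>"
  have "u \<le> \<bar>s / real (Suc n) - t / real (Suc n)\<bar>"
    unfolding u_def by (rule abs_exp_minus_diff_le) (use assms in auto)
  also have "\<dots> = \<bar>s - t\<bar> / real (Suc n)"
    by (simp add: diff_divide_distrib[symmetric] del: of_nat_Suc)
  also have "\<dots> \<le> \<bar>s - t\<bar>"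
    by (rule rate_le) simp
  finally have u: "u \<le> \<bar>s - t\<bar>" .
  have "c0_seq (blinfun_apply (blinfun_exp (s *\<^sub>R relaxation)) a
        - blinfun_apply (blinfun_exp (t *\<^sub>R relaxation)) a) n
      = complex_of_real (exp (- (s / real (Suc n))) - exp (- (t / real (Suc n))))
        * (c0_seq a n - c0_seq a 0)"
    by (simp add: minus_c0.rep_eq exp_relaxation_nth algebra_simps)
  then have "cmod (c0_seq (blinfun_apply (blinfun_exp (s *\<^sub>R relaxation)) a
        - blinfun_apply (blinfun_exp (t *\<^sub>R relaxation)) a) n)
      = u * cmod (c0_seq a n - c0_seq a 0)"
    by (simp only: norm_mult norm_of_real u_def)
  also have "\<dots> \<le> \<bar>s - t\<bar> * (2 * norm a)"
    by (rule mult_mono[OF u c0_seq_diff_le]) auto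
  finally show "cmod (c0_seq (blinfun_apply (blinfun_exp (s *\<^sub>R relaxation)) a
        - blinfun_apply (blinfun_exp (t *\<^sub>R relaxation)) a) n) \<le> 2 * norm a * \<bar>s - t\<bar>"
    by (simp add: mult.commute)
qed

lemma exp_relaxation_0: "blinfun_apply (blinfun_exp (0 *\<^sub>R relaxation)) a = a"
  by (rule c0_eqI) (simp only: exp_relaxation_nth, simp)

text \<open>The remainder of the scalar exponential is quadratic in \<open>h / (n + 1)\<close>, which is at most \<open>h\<close>
  because all rates are at most 1.  Hence the difference quotients converge in norm, for every
  vector, and not merely coordinatewise.\<close>

lemma exp_relaxation_difference_quotient:
  assumes h: "0 < h"
  shows "norm ((1 / h) *\<^sub>R (blinfun_apply (blinfun_exp (h *\<^sub>R relaxation)) a - a)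
      - blinfun_apply relaxation a) \<le> 2 * norm a * h"
proof (rule c0_norm_le)
  fix n
  define x where "x = h / real (Suc n)"
  have x: "0 \<le> x" "x \<le> h"
    using h rate_le[of h n] by (simp_all add: x_def)
  have "c0_seq ((1 / h) *\<^sub>R (blinfun_apply (blinfun_exp (h *\<^sub>R relaxation)) a - a)
        - blinfun_apply relaxation a) n
      = complex_of_real (1 / h)
          * (c0_seq a 0 + complex_of_real (exp (- x)) * (c0_seq a n - c0_seq a 0) - c0_seq a n)
        - (c0_seq a 0 - c0_seq a n) / complex_of_real (real (Suc n))"
    by (simp add: minus_c0.rep_eq scaleR_c0.rep_eq exp_relaxation_nth relaxation_nth x_def)
  also have "\<dots> = complex_of_real ((exp (- x) - 1 + x) / h) * (c0_seq a n - c0_seq a 0)"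
  proof -
    have "complex_of_real x = complex_of_real h / complex_of_real (real (Suc n))"
      by (simp add: x_def)
    then have "(c0_seq a 0 - c0_seq a n) / complex_of_real (real (Suc n))
        = complex_of_real (1 / h) * complex_of_real x * (c0_seq a 0 - c0_seq a n)"
      using h by simp
    then show ?thesis
      by (simp add: algebra_simps add_divide_distrib diff_divide_distrib)
  qed
  finally have "cmod (c0_seq ((1 / h) *\<^sub>R (blinfun_apply (blinfun_exp (h *\<^sub>R relaxation)) a - a)
        - blinfun_apply relaxation a) n)
      = \<bar>(exp (- x) - 1 + x) / h\<bar> * cmod (c0_seq a n - c0_seq a 0)"
    by (simp only: norm_mult norm_of_real)
  also have "\<dots> \<le> h * (2 * norm a)"
  proof (rule mult_mono[OF _ c0_seq_diff_le])
    have "\<bar>exp (- x) - 1 + x\<bar> \<le> x\<^sup>2"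
      by (rule exp_minus_second_order[OF x(1)])
    also have "\<dots> \<le> h\<^sup>2"
      using x by (intro power_mono) auto
    finally show "\<bar>(exp (- x) - 1 + x) / h\<bar> \<le> h"
      using h by (simp add: field_simps power2_eq_square)
  qed (use h in auto)
  finally show "cmod (c0_seq ((1 / h) *\<^sub>R (blinfun_apply (blinfun_exp (h *\<^sub>R relaxation)) a - a)
        - blinfun_apply relaxation a) n) \<le> 2 * norm a * h"
    by (simp add: mult.commute)
qed

text \<open>Only the values at positive times are prescribed, in accordance with the definition of a
  semigroup indexed by \<open>t > 0\<close>.\<close>

locale relaxation_semigroup =
  fixes T :: "real \<Rightarrow> c0 \<Rightarrow>\<^sub>L c0"
  assumes T_eq: "\<And>t. t > 0 \<Longrightarrow> T t = blinfun_exp (t *\<^sub>R relaxation)"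
begin

lemma T_nth:
  assumes "t > 0"
  shows "c0_seq (blinfun_apply (T t) a) n
    = c0_seq a 0 + complex_of_real (exp (- t / real (Suc n))) * (c0_seq a n - c0_seq a 0)"
  by (simp only: T_eq[OF assms] exp_relaxation_nth)

lemma contraction_semigroup: "C0_contraction_semigroup T"
  unfolding C0_contraction_semigroup_def C0_semigroup_def
proof (intro conjI allI impI)
  fix t :: real assume t: "t > 0"
  show "clinear (T t)"
    unfolding clinear_def using t
    by (intro allI c0_eqI) (simp add: T_nth scaleC_c0.rep_eq algebra_simps)
  show "norm (T t) \<le> 1"
    using t norm_exp_relaxation_le[of t] by (simp add: T_eq)
  fix s :: real assume s: "s > 0"
  show "T (s + t) = T s o\<^sub>L T t"
  proof (intro blinfun_eqI c0_eqI)
    fix a n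
    have "exp (- (s + t) / real (Suc n)) = exp (- s / real (Suc n)) * exp (- t / real (Suc n))"
      by (simp add: exp_add[symmetric] diff_divide_distrib del: of_nat_Suc)
    then show "c0_seq (blinfun_apply (T (s + t)) a) n = c0_seq (blinfun_apply (T s o\<^sub>L T t) a) n"
      using s t by (simp only: T_nth add_pos_pos blinfun_apply_blinfun_compose of_real_mult)
        (simp add: algebra_simps)
  qed
next
  fix a
  have lipschitz: "(2 * norm a)-lipschitz_on {0..}
      (\<lambda>t. blinfun_apply (blinfun_exp (t *\<^sub>R relaxation)) a)"
    using exp_relaxation_lipschitz by (intro lipschitz_onI) (auto simp: dist_norm)
  have cont: "continuous_on {0..} (\<lambda>t. blinfun_apply (blinfun_exp (t *\<^sub>R relaxation)) a)"
    by (rule lipschitz_on_continuous_on[OF lipschitz])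
  then have "continuous_on {0<..} (\<lambda>t. blinfun_apply (blinfun_exp (t *\<^sub>R relaxation)) a)"
    by (rule continuous_on_subset) auto
  then show "continuous_on {0<..} (\<lambda>t. blinfun_apply (T t) a)"
    by (rule continuous_on_eq) (simp add: T_eq)
  have "((\<lambda>t. blinfun_apply (blinfun_exp (t *\<^sub>R relaxation)) a)
      \<longlongrightarrow> blinfun_apply (blinfun_exp (0 *\<^sub>R relaxation)) a) (at 0 within {0..})"
    using cont unfolding continuous_on_def by (rule bspec) simp
  then have "((\<lambda>t. blinfun_apply (blinfun_exp (t *\<^sub>R relaxation)) a)
      \<longlongrightarrow> blinfun_apply (blinfun_exp (0 *\<^sub>R relaxation)) a) (at_right 0)"
    by (rule tendsto_within_subset) auto
  then have "((\<lambda>t. blinfun_apply (blinfun_exp (t *\<^sub>R relaxation)) a) \<longlongrightarrow> a) (at_right 0)"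
    by (simp only: exp_relaxation_0)
  then show "((\<lambda>t. blinfun_apply (T t) a) \<longlongrightarrow> a) (at_right 0)"
    by (rule Lim_transform_eventually)
      (auto simp: eventually_at_right_less T_eq intro: eventually_mono[OF eventually_at_right_less])
qed

lemma difference_quotient_tendsto:
  "((\<lambda>h. (1 / h) *\<^sub>R (blinfun_apply (T h) a - a)) \<longlongrightarrow> blinfun_apply relaxation a) (at_right 0)"
proof (rule LIM_zero_cancel[OF Lim_null_comparison])
  show "\<forall>\<^sub>F h in at_right 0.
      norm ((1 / h) *\<^sub>R (blinfun_apply (T h) a - a) - blinfun_apply relaxation a)
        \<le> 2 * norm a * h"
    using eventually_at_right_less
    by eventually_elim (simp only: T_eq exp_relaxation_difference_quotient)
  have "((\<lambda>h. 2 * norm a * h) \<longlongrightarrow> 2 * norm a * 0) (at_right 0)"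
    by (intro tendsto_intros)
  then show "((\<lambda>h. 2 * norm a * h) \<longlongrightarrow> 0) (at_right 0)"
    by simp
qed

lemma generator_domain_eq: "generator_domain T = UNIV"
  unfolding generator_domain_def using difference_quotient_tendsto by blast

lemma generator_eq: "generator T = blinfun_apply relaxation"
  unfolding generator_def fun_eq_iff
  by (intro allI tendsto_Lim difference_quotient_tendsto) simp

lemma T_unit_vec_1:
  assumes t: "t > 0"
  shows "(\<lambda>n. complex_of_real (1 - exp (- t / real (n + 2))) *\<^sub>C unit_vec (n + 2))
    sums (blinfun_apply (T t) (unit_vec 1) - unit_vec 1)"
  using unit_vec_expansion_from_2[of "blinfun_apply (T t) (unit_vec 1) - unit_vec 1"] t
  by (simp add: T_nth unit_vec_nth minus_c0.rep_eq)

lemma T_unit_vec: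
  assumes "t > 0" "i \<ge> 2"
  shows "blinfun_apply (T t) (unit_vec i) = complex_of_real (exp (- t / real i)) *\<^sub>C unit_vec i"
  using assms by (intro c0_eqI) (auto simp: T_nth unit_vec_nth scaleC_c0.rep_eq)

end


section \<open>The first coordinate functional\<close>

lemma l1_functional_unit_vec_1:
  "blinfun_apply (l1_functional (c0_seq (unit_vec 1))) a = c0_seq a 0"
proof -
  have "summable (\<lambda>n. cmod (c0_seq (unit_vec 1) n))"
    by (rule summable_finite[of "{0}"]) (auto simp: unit_vec_nth)
  then have "blinfun_apply (l1_functional (c0_seq (unit_vec 1))) a
      = (\<Sum>n. c0_seq a n * c0_seq (unit_vec 1) n)"
    by (rule l1_functional_apply)
  also have "\<dots> = (\<Sum>n\<in>{0}. c0_seq a n * c0_seq (unit_vec 1) n)"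
    by (rule suminf_finite) (auto simp: unit_vec_nth)
  finally show ?thesis by (simp add: unit_vec_nth)
qed

lemma l1_functional_unit_vec_1_duality:
  "l1_functional (c0_seq (unit_vec 1)) \<in> duality_map (unit_vec 1)" (is "?f \<in> _")
proof -
  have "norm ?f \<le> 1"
    by (rule norm_blinfun_bound) (simp_all only: l1_functional_unit_vec_1, simp_all add: c0_norm_ge)
  moreover have "1 \<le> norm ?f"
    using norm_blinfun[of ?f "unit_vec 1"] norm_unit_vec_Suc[of 0]
    by (simp only: l1_functional_unit_vec_1) (simp add: unit_vec_nth)
  moreover have "clinear ?f"
    unfolding clinear_def l1_functional_unit_vec_1
    by (simp add: scaleC_c0.rep_eq scaleC_complex_def)
  moreover have "blinfun_apply ?f (unit_vec 1) = 1"
    unfolding l1_functional_unit_vec_1 by (simp add: unit_vec_nth)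
  ultimately show ?thesis by (simp add: duality_map_def)
qed

lemma (in relaxation_semigroup) pairing_eq_1:
  assumes "t > 0"
  shows "blinfun_apply (l1_functional (c0_seq (unit_vec 1))) (blinfun_apply (T t) (unit_vec 1)) = 1"
  unfolding l1_functional_unit_vec_1 T_nth[OF assms] by (simp add: unit_vec_nth)


section \<open>No decay and no imaginary eigenvalue\<close>

theorem mainTheorem1:
  shows
    "(\<exists>!A. determining_conditions A) \<and>
     (\<forall>(A :: c0 \<Rightarrow>\<^sub>L c0) (T :: real \<Rightarrow> c0 \<Rightarrow>\<^sub>L c0) (e1s :: c0 \<Rightarrow>\<^sub>L complex).
        determining_conditions A \<longrightarrow>
        (\<forall>t>0. T t = blinfun_exp (t *\<^sub>R A)) \<longrightarrow>
        e1s = l1_functional (c0_seq (unit_vec 1)) \<longrightarrow>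
          (\<forall>t>0. (\<lambda>n. complex_of_real (1 - exp (- t / real (n + 2))) *\<^sub>C unit_vec (n + 2))
                    sums (blinfun_apply (T t) (unit_vec 1) - unit_vec 1)) \<and>
          (\<forall>t>0. \<forall>i\<ge>2. blinfun_apply (T t) (unit_vec i)
                    = complex_of_real (exp (- t / real i)) *\<^sub>C unit_vec i) \<and>
          C0_contraction_semigroup T \<and>
          generator_domain T = UNIV \<and> generator T = blinfun_apply A \<and>
          e1s \<in> duality_map (unit_vec 1) \<and>
          (\<forall>t>0. blinfun_apply e1s (blinfun_apply (T t) (unit_vec 1)) = 1) \<and>
          \<not> (\<exists>y c. Re c = 0 \<and> eigenvector_on UNIV (blinfun_apply A) c y) \<and>
          (\<forall>k\<ge>2. eigenvector_on UNIV (blinfun_apply A)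
                    (complex_of_real (- (1 / real k))) (unit_vec k))) \<and>
     (\<exists>(T :: real \<Rightarrow> c0 \<Rightarrow>\<^sub>L c0) (x :: c0) (xs :: c0 \<Rightarrow>\<^sub>L complex).
        C0_contraction_semigroup T \<and> norm x = 1 \<and> xs \<in> duality_map x \<and>
        ((\<lambda>t. cmod (blinfun_apply xs (blinfun_apply (T t) x))) \<longlongrightarrow> 1) at_top \<and>
        \<not> (\<exists>y c. norm y = 1 \<and> Re c = 0 \<and>
              eigenvector_on (generator_domain T) (generator T) c y))"
proof -
  have no_eig: "\<not> (\<exists>y c. Re c = 0 \<and> eigenvector_on UNIV (blinfun_apply relaxation) c y)"
    using relaxation_no_imaginary_eigenvalue by (auto simp: eigenvector_on_def)
  have eig: "eigenvector_on UNIV (blinfun_apply relaxation)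
      (complex_of_real (- (1 / real k))) (unit_vec k)" if "k \<ge> 2" for k
  proof -
    have "norm (unit_vec k) = 1"
      using norm_unit_vec_Suc[of "k - 1"] that by simp
    then show ?thesis
      using relaxation_unit_vec[OF that] by (auto simp: eigenvector_on_def)
  qed
  show ?thesis
  proof (intro conjI, goal_cases)
    case 1
    show ?case
      by (simp add: determining_conditions_iff)
  next
    case 2
    show ?case
    proof (intro allI impI, goal_cases)
      case (1 A T e1s)
      have A: "A = relaxation"
        using 1(1) by (simp only: determining_conditions_iff)
      interpret relaxation_semigroup T
        by unfold_locales (use 1(2) A in simp)
      show ?case
        unfolding 1(3) A
        by (intro conjI allI impI T_unit_vec_1 T_unit_vec contraction_semigroup
            generator_domain_eq generator_eq l1_functional_unit_vec_1_duality pairing_eq_1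
            no_eig eig)
    qed
  next
    case 3
    define T where "T t = blinfun_exp (t *\<^sub>R relaxation)" for t
    interpret relaxation_semigroup T
      by unfold_locales (rule T_def)
    have "\<forall>\<^sub>F t in at_top. cmod (blinfun_apply (l1_functional (c0_seq (unit_vec 1)))
        (blinfun_apply (T t) (unit_vec 1))) = 1"
      using eventually_gt_at_top[of 0] by eventually_elim (simp only: pairing_eq_1 norm_one)
    then have "((\<lambda>t. cmod (blinfun_apply (l1_functional (c0_seq (unit_vec 1)))
        (blinfun_apply (T t) (unit_vec 1)))) \<longlongrightarrow> 1) at_top"
      by (rule tendsto_eventually)
    moreover have "norm (unit_vec 1) = 1"
      using norm_unit_vec_Suc[of 0] by simp
    moreover have "\<not> (\<exists>y c. norm y = 1 \<and> Re c = 0 \<and>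
        eigenvector_on (generator_domain T) (generator T) c y)"
      unfolding generator_domain_eq generator_eq using no_eig by blast
    ultimately show ?case
      using contraction_semigroup l1_functional_unit_vec_1_duality by blast
  qed
qed

end
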